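(* Let $M\ge 2$, let $0\le p_1\le p_2\le\dots\le p_M$ be not all equal, and let $0<q_1\le q_2\le\dots\le q_M$ be not all equal. Set $p=\frac1M\sum_{i=1}^M p_i$ and $q=\frac1M\sum_{i=1}^M q_i$. Let $f^{\rm het}(t)$ be the expected fraction of adopters in the complete network with $M$ nodes, external rates $\{p_i\}_{i=1}^M$ and internal rates $q_{i,j}=\frac{q_j}{M-1}$ for all $i\neq j$. Let $f^{\rm hom}(t)$ be the expected fraction of adopters in the homogeneous complete network with $M$ nodes, external rates all equal to $p$, and internal rates $q_{i,j}=\frac{q}{M-1}$ for all $i\ne j$. Then $$f^{\rm het}(t)<f^{\rm hom}(t),\qquad 0<t<\infty .$$
   Context: Discrete Bass model: a network has $M$ nodes, external rates $p_j\ge 0$ and internal rates $q_{i,j}\ge 0$ ($i\ne j$; the influence of $i$ on $j$). $X_j(t)\in\{0,1\}$ is the state of node $j$ ($1$ = adopter), $X_j(0)=0$ for all $j$. The process $(X_1,\dots,X_M)$ is a continuous-time Markov chain in which adopters remain adopters forever, and each nonadopter $j$ becomes an adopter at rate $p_j+\sum_{k\ne j}q_{k,j}X_k(t)$ (one node changes at a time). The expected fraction of adopters is $f(t)=\frac1M\,\mathbf{E}\big[\sum_{j=1}^M X_j(t)\big]$. *)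

theory Defs
  imports "HOL-Probability.Probability"
begin

(* Homogeneous transition functions on the finite state space S whose infinitesimal rate of jumping
   from x to a different state y is r x y.  The diagonal derivative at 0 is then determined, since
   the rows sum to 1; the values of r on the diagonal are irrelevant. *)
definition transition_function ::
  "'s set \<Rightarrow> ('s \<Rightarrow> 's \<Rightarrow> real) \<Rightarrow> (real \<Rightarrow> 's \<Rightarrow> 's \<Rightarrow> real) \<Rightarrow> bool" where
  "transition_function S r P \<longleftrightarrow>
     (\<forall>t\<ge>0. \<forall>x\<in>S. (\<forall>y\<in>S. 0 \<le> P t x y) \<and> (\<Sum>y\<in>S. P t x y) = 1) \<and>
     (\<forall>x\<in>S. \<forall>y\<in>S. P 0 x y = (if x = y then 1 else 0)) \<and>
     (\<forall>s\<ge>0. \<forall>t\<ge>0. \<forall>x\<in>S. \<forall>y\<in>S. P (s + t) x y = (\<Sum>z\<in>S. P s x z * P t z y)) \<and>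
     (\<forall>x\<in>S. \<forall>y\<in>S. x \<noteq> y \<longrightarrow> ((\<lambda>h. P h x y / h) \<longlongrightarrow> r x y) (at_right 0))"

(* Y is a time-homogeneous continuous-time Markov chain (time in [0, infinity)) on the probability
   space \<Omega>, with finite state space S and jump rates r. *)
definition markov_chain ::
  "'w measure \<Rightarrow> 's set \<Rightarrow> ('s \<Rightarrow> 's \<Rightarrow> real) \<Rightarrow> (real \<Rightarrow> 'w \<Rightarrow> 's) \<Rightarrow> bool" where
  "markov_chain \<Omega> S r Y \<longleftrightarrow>
     prob_space \<Omega> \<and> finite S \<and>
     (\<forall>t\<ge>0. Y t \<in> measurable \<Omega> (count_space S)) \<and>
     (\<exists>P. transition_function S r P \<and>
        (\<forall>(n::nat) (\<tau>::nat \<Rightarrow> real) x t y.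
           0 \<le> \<tau> 0 \<longrightarrow> strict_mono_on {..n} \<tau> \<longrightarrow> \<tau> n \<le> t \<longrightarrow> (\<forall>i\<le>n. x i \<in> S) \<longrightarrow> y \<in> S \<longrightarrow>
           0 < \<P>(\<omega> in \<Omega>. \<forall>i\<le>n. Y (\<tau> i) \<omega> = x i) \<longrightarrow>
           \<P>(\<omega> in \<Omega>. Y t \<omega> = y \<bar> \<forall>i\<le>n. Y (\<tau> i) \<omega> = x i) = P (t - \<tau> n) (x n) y))"

(* Network states: x j = 1 iff node j is an adopter (x is undefined outside the nodes 1, ..., M). *)
definition bass_states :: "nat \<Rightarrow> (nat \<Rightarrow> nat) set" where
  "bass_states M = {1..M} \<rightarrow>\<^sub>E {0, 1}"

(* The outer sum has at most one term: the only positive rates are those of the transitions in which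
   a single nonadopter j becomes an adopter, so adopters never revert. *)
definition bass_rate ::
  "nat \<Rightarrow> (nat \<Rightarrow> real) \<Rightarrow> (nat \<Rightarrow> nat \<Rightarrow> real) \<Rightarrow> (nat \<Rightarrow> nat) \<Rightarrow> (nat \<Rightarrow> nat) \<Rightarrow> real" where
  "bass_rate M p q x y =
     (\<Sum>j | j \<in> {1..M} \<and> x j = 0 \<and> y = x(j := 1).
        p j + (\<Sum>k\<in>{1..M} - {j}. q k j * real (x k)))"

(* X t \<omega> j is the state of node j at time t; q i j is the influence of node i on node j. *)
definition bass_process ::
  "'w measure \<Rightarrow> nat \<Rightarrow> (nat \<Rightarrow> real) \<Rightarrow> (nat \<Rightarrow> nat \<Rightarrow> real) \<Rightarrow> (real \<Rightarrow> 'w \<Rightarrow> nat \<Rightarrow> nat) \<Rightarrow> bool" where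
  "bass_process \<Omega> M p q X \<longleftrightarrow>
     markov_chain \<Omega> (bass_states M) (bass_rate M p q) X \<and>
     (AE \<omega> in \<Omega>. \<forall>j\<in>{1..M}. X 0 \<omega> j = 0)"

definition expected_adopter_fraction ::
  "'w measure \<Rightarrow> nat \<Rightarrow> (real \<Rightarrow> 'w \<Rightarrow> nat \<Rightarrow> nat) \<Rightarrow> real \<Rightarrow> real" where
  "expected_adopter_fraction \<Omega> M X t =
     1 / real M * (LINT \<omega>|\<Omega>. (\<Sum>j=1..M. real (X t \<omega> j)))"

end

(* Let \<rho> j k = p j + q j k / (M - 1) be the rate at which a nonadopter j adopts when there are k
   adopters, and \<mu> t A the probability that A is the set of adopters at time t.  Since p and q are
   ordered in the same way, i \<le> j gives \<rho> i k \<le> \<rho> j k for all k.  By induction on the size of a set B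
   without i and j, the forward equations for B \<union> {i} and B \<union> {j} show that D = \<mu> t (B \<union> {j}) - \<mu> t (B \<union> {i})
   satisfies D' + c D \<ge> 0, hence D \<ge> 0: given k adopters, the faster nodes are the more likely adopters.
   By Chebyshev's sum inequality the nonadopters then adopt at a mean total rate of at most
   M - k times the average of \<rho> j k over all nodes j, which is the total rate of the homogeneous network.
   Comparing, by induction on k, the differential equations for the probabilities T k of at least k
   adopters shows that no T k is larger in the heterogeneous network, and T 2 is strictly smaller because
   Chebyshev's inequality is strict for k = 1.  Finally the expected number of adopters is the sum of
   all T k with k \<ge> 1. *)

theory Submission imports Defs begin

section \<open>Transition functions of finite Markov chains\<close>

lemma transition_functionD:
  assumes P: "transition_function S r P"
  shows "0 \<le> t \<Longrightarrow> x \<in> S \<Longrightarrow> y \<in> S \<Longrightarrow> 0 \<le> P t x y"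
    and "0 \<le> t \<Longrightarrow> x \<in> S \<Longrightarrow> (\<Sum>y\<in>S. P t x y) = 1"
    and "x \<in> S \<Longrightarrow> y \<in> S \<Longrightarrow> P 0 x y = (if x = y then 1 else 0)"
    and "0 \<le> s \<Longrightarrow> 0 \<le> t \<Longrightarrow> x \<in> S \<Longrightarrow> y \<in> S \<Longrightarrow> P (s + t) x y = (\<Sum>z\<in>S. P s x z * P t z y)"
    and "x \<in> S \<Longrightarrow> y \<in> S \<Longrightarrow> x \<noteq> y \<Longrightarrow> ((\<lambda>h. P h x y / h) \<longlongrightarrow> r x y) (at_right 0)"
proof -
  note D = P[unfolded transition_function_def]
  show "0 \<le> t \<Longrightarrow> x \<in> S \<Longrightarrow> y \<in> S \<Longrightarrow> 0 \<le> P t x y"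
    by (rule D[THEN conjunct1, rule_format, THEN conjunct1, rule_format])
  show "0 \<le> t \<Longrightarrow> x \<in> S \<Longrightarrow> (\<Sum>y\<in>S. P t x y) = 1"
    by (rule D[THEN conjunct1, rule_format, THEN conjunct2])
  show "x \<in> S \<Longrightarrow> y \<in> S \<Longrightarrow> P 0 x y = (if x = y then 1 else 0)"
    by (rule D[THEN conjunct2, THEN conjunct1, rule_format])
  show "0 \<le> s \<Longrightarrow> 0 \<le> t \<Longrightarrow> x \<in> S \<Longrightarrow> y \<in> S \<Longrightarrow> P (s + t) x y = (\<Sum>z\<in>S. P s x z * P t z y)"
    by (rule D[THEN conjunct2, THEN conjunct2, THEN conjunct1, rule_format])
  show "x \<in> S \<Longrightarrow> y \<in> S \<Longrightarrow> x \<noteq> y \<Longrightarrow> ((\<lambda>h. P h x y / h) \<longlongrightarrow> r x y) (at_right 0)"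
    by (rule D[THEN conjunct2, THEN conjunct2, THEN conjunct2, rule_format])
qed

text \<open>Subtracting \<open>f z\<close> kills the diagonal term, so the off-diagonal rates alone
  determine the limit.\<close>

lemma transition_function_tendsto_generator:
  assumes P: "transition_function S r P" and z: "z \<in> S"
  shows "((\<lambda>h. (\<Sum>y\<in>S. P h z y * (f y - f z)) / h) \<longlongrightarrow> (\<Sum>y\<in>S. r z y * (f y - f z))) (at_right 0)"
proof -
  have "((\<lambda>h. \<Sum>y\<in>S. P h z y / h * (f y - f z)) \<longlongrightarrow> (\<Sum>y\<in>S. r z y * (f y - f z))) (at_right 0)"
  proof (intro tendsto_sum)
    fix y assume y: "y \<in> S"
    show "((\<lambda>h. P h z y / h * (f y - f z)) \<longlongrightarrow> r z y * (f y - f z)) (at_right 0)"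
    proof (cases "z = y")
      case False
      then have "((\<lambda>h. P h z y / h) \<longlongrightarrow> r z y) (at_right 0)"
        using transition_functionD(5)[OF P z y] by simp
      then show ?thesis by (intro tendsto_mult tendsto_const)
    qed auto
  qed
  then show ?thesis by (simp add: sum_divide_distrib)
qed

text \<open>Chapman-Kolmogorov summed against \<open>f\<close>; the centring by \<open>f z\<close>
  costs nothing because the rows of \<open>P h\<close> sum to 1.\<close>

lemma transition_function_increment:
  fixes f :: "'s \<Rightarrow> real"
  assumes P: "transition_function S r P" and x: "x \<in> S" and st: "0 \<le> s" "0 \<le> h"
  shows "(\<Sum>y\<in>S. P (s + h) x y * f y) - (\<Sum>y\<in>S. P s x y * f y)
    = (\<Sum>z\<in>S. P s x z * (\<Sum>y\<in>S. P h z y * (f y - f z)))"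
proof -
  have "(\<Sum>y\<in>S. P (s + h) x y * f y) = (\<Sum>y\<in>S. (\<Sum>z\<in>S. P s x z * P h z y) * f y)"
  proof (rule sum.cong[OF refl])
    fix y assume "y \<in> S"
    then have "P (s + h) x y = (\<Sum>z\<in>S. P s x z * P h z y)"
      using transition_functionD(4)[OF P st x] by simp
    then show "P (s + h) x y * f y = (\<Sum>z\<in>S. P s x z * P h z y) * f y" by simp
  qed
  also have "\<dots> = (\<Sum>y\<in>S. \<Sum>z\<in>S. P s x z * (P h z y * f y))"
    by (simp only: sum_distrib_right mult.assoc)
  also have "\<dots> = (\<Sum>z\<in>S. \<Sum>y\<in>S. P s x z * (P h z y * f y))"
    by (rule sum.swap)
  also have "\<dots> = (\<Sum>z\<in>S. P s x z * (\<Sum>y\<in>S. P h z y * f y))"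
    by (simp only: sum_distrib_left)
  finally have 1: "(\<Sum>y\<in>S. P (s + h) x y * f y) = (\<Sum>z\<in>S. P s x z * (\<Sum>y\<in>S. P h z y * f y))" .
  have 2: "(\<Sum>y\<in>S. P h z y * (f y - f z)) = (\<Sum>y\<in>S. P h z y * f y) - f z" if "z \<in> S" for z
  proof -
    have "(\<Sum>y\<in>S. P h z y) = 1" using transition_functionD(2)[OF P st(2) that] .
    then show ?thesis by (simp only: right_diff_distrib sum_subtractf sum_distrib_right[symmetric] mult_1)
  qed
  have "(\<Sum>z\<in>S. P s x z * (\<Sum>y\<in>S. P h z y * (f y - f z))) = (\<Sum>z\<in>S. P s x z * ((\<Sum>y\<in>S. P h z y * f y) - f z))"
    using 2 by (intro sum.cong) auto
  then show ?thesis unfolding 1 by (simp only: right_diff_distrib sum_subtractf)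
qed

lemma transition_function_bounds:
  assumes P: "transition_function S r P" and fin: "finite S" and "x \<in> S" "y \<in> S" "0 \<le> t"
  shows "0 \<le> P t x y" "P t x y \<le> 1"
proof -
  note nn = transition_functionD(1)[OF P \<open>0 \<le> t\<close> \<open>x \<in> S\<close>]
  show "0 \<le> P t x y" using nn[OF \<open>y \<in> S\<close>] .
  show "P t x y \<le> 1"
    using member_le_sum[OF \<open>y \<in> S\<close> _ fin, of "P t x"] nn
      transition_functionD(2)[OF P \<open>0 \<le> t\<close> \<open>x \<in> S\<close>] by simp
qed

text \<open>Transports limits in the step length, at 0 from the right, to limits in the time
  \<open>s\<close> at \<open>t\<close> from either side.\<close>

lemma filterlim_abs_diff_at_right_0:
  "filterlim (\<lambda>s::real. \<bar>s - t\<bar>) (at_right 0) (at t within A)"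
proof -
  have "((\<lambda>s. \<bar>s - t\<bar>) \<longlongrightarrow> \<bar>t - t\<bar>) (at t within A)" by (intro tendsto_intros)
  then show ?thesis unfolding filterlim_at by (auto simp: eventually_at_filter)
qed

(* The Chapman-Kolmogorov equation is applied at min s t, so that one formula serves both one-sided
   difference quotients. *)
lemma transition_function_quotient:
  fixes f :: "'s \<Rightarrow> real"
  assumes P: "transition_function S r P" and x: "x \<in> S" and st: "0 \<le> s" "0 \<le> t" "s \<noteq> t"
  shows "((\<Sum>y\<in>S. P s x y * f y) - (\<Sum>y\<in>S. P t x y * f y)) / (s - t)
    = (\<Sum>z\<in>S. P (min s t) x z * ((\<Sum>y\<in>S. P \<bar>s - t\<bar> z y * (f y - f z)) / \<bar>s - t\<bar>))"
proof -
  have gen: "(\<Sum>z\<in>S. a z * b z) / h = (\<Sum>z\<in>S. a z * (b z / h))" for a b :: "'s \<Rightarrow> real" and h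
    by (simp add: sum_divide_distrib)
  show ?thesis
  proof (cases "s < t")
    case True
    have "((\<Sum>y\<in>S. P s x y * f y) - (\<Sum>y\<in>S. P t x y * f y)) / (s - t)
      = ((\<Sum>y\<in>S. P t x y * f y) - (\<Sum>y\<in>S. P s x y * f y)) / (t - s)"
      by (metis minus_diff_eq minus_divide_divide)
    moreover have "s + (t - s) = t" "min s t = s" "\<bar>s - t\<bar> = t - s" "0 \<le> t - s"
      using True by auto
    ultimately show ?thesis
      using transition_function_increment[OF P x st(1), of "t - s" f] by (simp only: gen)
  next
    case False
    then have "t + (s - t) = s" "min s t = t" "\<bar>s - t\<bar> = s - t" "0 \<le> s - t"
      by auto
    then show ?thesis
      using transition_function_increment[OF P x st(2), of "s - t" f] by (simp only: gen)
  qed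
qed

text \<open>In \<open>transition_function_quotient\<close> the weights are probabilities, hence at
  most 1, and the inner quotients converge, so the increment is of order |s - t|. Continuity has to
  precede differentiability because the weights sit at \<open>min s t\<close>, which moves with
  \<open>s\<close> when \<open>s < t\<close>.\<close>

lemma transition_function_continuous:
  assumes P: "transition_function S r P" and fin: "finite S" and x: "x \<in> S" and z: "z \<in> S"
  shows "continuous_on {0..} (\<lambda>t. P t x z)"
  unfolding continuous_on_def
proof
  fix t :: real assume "t \<in> {0..}"
  then have t: "0 \<le> t" by simp
  \<comment> \<open>Summing against the indicator of \<open>z\<close> extracts the single entry
    \<open>P s x z\<close>.\<close>
  define f where "f y = (if y = z then 1 else 0 :: real)" for y
  define G where "G h w = (\<Sum>y\<in>S. P h w y * (f y - f w)) / h" for h w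
  define L where "L w = (\<Sum>y\<in>S. r w y * (f y - f w))" for w
  have F: "(\<Sum>y\<in>S. P s x y * f y) = P s x z" for s
    using fin z by (simp add: f_def if_distrib cong: if_cong)
  have G: "((\<lambda>s. G \<bar>s - t\<bar> w) \<longlongrightarrow> L w) (at t within {0..})" if "w \<in> S" for w
    unfolding G_def L_def
    by (rule filterlim_compose[OF transition_function_tendsto_generator[OF P that] filterlim_abs_diff_at_right_0])
  have "((\<lambda>s. \<bar>s - t\<bar> * (\<Sum>w\<in>S. \<bar>G \<bar>s - t\<bar> w\<bar>)) \<longlongrightarrow> \<bar>t - t\<bar> * (\<Sum>w\<in>S. \<bar>L w\<bar>)) (at t within {0..})"
    by (intro tendsto_intros G)
  then have lim: "((\<lambda>s. \<bar>s - t\<bar> * (\<Sum>w\<in>S. \<bar>G \<bar>s - t\<bar> w\<bar>)) \<longlongrightarrow> 0) (at t within {0..})"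
    by simp
  have "\<forall>\<^sub>F s in at t within {0..}. norm (P s x z - P t x z) \<le> \<bar>s - t\<bar> * (\<Sum>w\<in>S. \<bar>G \<bar>s - t\<bar> w\<bar>)"
    unfolding eventually_at_filter
  proof (intro always_eventually allI impI)
    fix s :: real assume s: "s \<noteq> t" "s \<in> {0..}"
    have "(P s x z - P t x z) / (s - t) = (\<Sum>w\<in>S. P (min s t) x w * G \<bar>s - t\<bar> w)"
      using transition_function_quotient[OF P x _ t s(1), of f] s by (simp only: F G_def atLeast_iff)
    moreover have "P s x z - P t x z = (s - t) * ((P s x z - P t x z) / (s - t))"
      using s by (simp only: right_minus_eq nonzero_mult_div_cancel_left times_divide_eq_right if_False simp_thms)
    ultimately have "P s x z - P t x z = (s - t) * (\<Sum>w\<in>S. P (min s t) x w * G \<bar>s - t\<bar> w)"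
      by (simp only:)
    then have "\<bar>P s x z - P t x z\<bar> = \<bar>s - t\<bar> * \<bar>\<Sum>w\<in>S. P (min s t) x w * G \<bar>s - t\<bar> w\<bar>"
      by (simp only: abs_mult)
    also have "\<bar>\<Sum>w\<in>S. P (min s t) x w * G \<bar>s - t\<bar> w\<bar> \<le> (\<Sum>w\<in>S. \<bar>G \<bar>s - t\<bar> w\<bar>)"
    proof (rule order_trans[OF sum_abs sum_mono])
      fix w assume w: "w \<in> S"
      have "0 \<le> min s t" using s t by simp
      from transition_function_bounds[OF P fin x w this]
      show "\<bar>P (min s t) x w * G \<bar>s - t\<bar> w\<bar> \<le> \<bar>G \<bar>s - t\<bar> w\<bar>"
        by (simp add: abs_mult mult_left_le_one_le)
    qed
    finally show "norm (P s x z - P t x z) \<le> \<bar>s - t\<bar> * (\<Sum>w\<in>S. \<bar>G \<bar>s - t\<bar> w\<bar>)"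
      by (simp only: real_norm_def mult_left_mono abs_ge_zero)
  qed
  from Lim_null_comparison[OF this lim]
  show "((\<lambda>t. P t x z) \<longlongrightarrow> P t x z) (at t within {0..})"
    by (rule LIM_zero_cancel)
qed

text \<open>Kolmogorov's forward equation tested against \<open>f\<close> (Dynkin's formula). It is
  the limit of \<open>transition_function_quotient\<close>: inner quotients tend to the generator,
  weights converge by continuity. At \<open>t = 0\<close> the derivative is one-sided.\<close>

lemma transition_function_has_derivative:
  fixes f :: "'s \<Rightarrow> real"
  assumes P: "transition_function S r P" and fin: "finite S" and x: "x \<in> S" and t: "0 \<le> t"
  shows "((\<lambda>t. \<Sum>y\<in>S. P t x y * f y) has_real_derivative
    (\<Sum>z\<in>S. P t x z * (\<Sum>y\<in>S. r z y * (f y - f z)))) (at t within {0..})"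
  unfolding has_field_derivative_iff
proof (rule Lim_transform_eventually)
  show "((\<lambda>s. \<Sum>z\<in>S. P (min s t) x z * ((\<Sum>y\<in>S. P \<bar>s - t\<bar> z y * (f y - f z)) / \<bar>s - t\<bar>)) \<longlongrightarrow>
    (\<Sum>z\<in>S. P t x z * (\<Sum>y\<in>S. r z y * (f y - f z)))) (at t within {0..})"
  proof (intro tendsto_sum tendsto_mult)
    fix z assume z: "z \<in> S"
    show "((\<lambda>s. (\<Sum>y\<in>S. P \<bar>s - t\<bar> z y * (f y - f z)) / \<bar>s - t\<bar>) \<longlongrightarrow> (\<Sum>y\<in>S. r z y * (f y - f z)))
      (at t within {0..})"
      by (rule filterlim_compose[OF transition_function_tendsto_generator[OF P z] filterlim_abs_diff_at_right_0])
    have "continuous_on {0..} (\<lambda>s. P (min s t) x z)"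
      by (rule continuous_on_compose2[OF transition_function_continuous[OF P fin x z]])
         (use t in \<open>auto intro!: continuous_intros\<close>)
    then show "((\<lambda>s. P (min s t) x z) \<longlongrightarrow> P t x z) (at t within {0..})"
      using t by (auto simp: continuous_on_def dest!: bspec[of _ _ t])
  qed
  show "\<forall>\<^sub>F s in at t within {0..}. (\<Sum>z\<in>S. P (min s t) x z * ((\<Sum>y\<in>S. P \<bar>s - t\<bar> z y * (f y - f z)) / \<bar>s - t\<bar>)) =
     ((\<Sum>y\<in>S. P s x y * f y) - (\<Sum>y\<in>S. P t x y * f y)) / (s - t)"
    unfolding eventually_at_filter
    using transition_function_quotient[OF P x _ t, symmetric] by (intro always_eventually) auto
qed

section \<open>Laws of chains started in a fixed state\<close>

lemma markov_chain_law:
  assumes X: "markov_chain \<Omega> S r X" and x: "x \<in> S" and X0: "AE \<omega> in \<Omega>. X 0 \<omega> = x"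
  obtains P where "transition_function S r P"
    "\<And>t y. 0 \<le> t \<Longrightarrow> y \<in> S \<Longrightarrow> \<P>(\<omega> in \<Omega>. X t \<omega> = y) = P t x y"
proof -
  interpret prob_space \<Omega> using X unfolding markov_chain_def by blast
  have meas: "X t \<in> measurable \<Omega> (count_space S)" if "0 \<le> t" for t
    using X that unfolding markov_chain_def by blast
  obtain P where P: "transition_function S r P"
    and cond: "\<And>(n::nat) (\<tau>::nat \<Rightarrow> real) x t y.
           0 \<le> \<tau> 0 \<Longrightarrow> strict_mono_on {..n} \<tau> \<Longrightarrow> \<tau> n \<le> t \<Longrightarrow> (\<forall>i\<le>n. x i \<in> S) \<Longrightarrow> y \<in> S \<Longrightarrow>
           0 < \<P>(\<omega> in \<Omega>. \<forall>i\<le>n. X (\<tau> i) \<omega> = x i) \<Longrightarrow>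
           \<P>(\<omega> in \<Omega>. X t \<omega> = y \<bar> \<forall>i\<le>n. X (\<tau> i) \<omega> = x i) = P (t - \<tau> n) (x n) y"
    using X unfolding markov_chain_def by blast
  have sets: "{\<omega> \<in> space \<Omega>. X t \<omega> = y} \<in> sets \<Omega>" if "0 \<le> t" "y \<in> S" for t y
  proof -
    have "X t -` {y} \<inter> space \<Omega> \<in> sets \<Omega>"
      by (rule measurable_sets[OF meas[OF that(1)]]) (use that in auto)
    also have "X t -` {y} \<inter> space \<Omega> = {\<omega> \<in> space \<Omega>. X t \<omega> = y}" by auto
    finally show ?thesis .
  qed
  have one: "\<P>(\<omega> in \<Omega>. X 0 \<omega> = x) = 1"
    using X0 prob_Collect_eq_1[OF sets[of 0 x]] x by simp
  show ?thesis
  proof (rule that[OF P])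
    fix t :: real and y assume t: "0 \<le> t" and y: "y \<in> S"
    have "\<P>(\<omega> in \<Omega>. X t \<omega> = y \<bar> X 0 \<omega> = x) = P t x y"
      \<comment> \<open>The Markov property with the single conditioning time 0; conditioning on an
        event of probability 1 does not change the law.\<close>
      using cond[of "\<lambda>_. 0" 0 t "\<lambda>_. x" y] t y x one by (simp add: strict_mono_on_def monotone_on_def)
    moreover have "\<P>(\<omega> in \<Omega>. X t \<omega> = y \<and> X 0 \<omega> = x) = \<P>(\<omega> in \<Omega>. X t \<omega> = y)"
      by (rule prob_eq_AE) (use X0 sets[OF t y] sets[OF order_refl x] in \<open>auto intro: sets.sets_Collect_conj\<close>)
    ultimately show "\<P>(\<omega> in \<Omega>. X t \<omega> = y) = P t x y"
      by (simp add: cond_prob_def one)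
  qed
qed

section \<open>The set of adopters of a Bass process\<close>

(* V is the set of nodes, \<rho> j k the adoption rate of node j in the presence of k adopters, and \<mu> t A
   the probability that A is the set of adopters at time t. *)
locale set_growth =
  fixes V :: "'v set" and \<rho> :: "'v \<Rightarrow> nat \<Rightarrow> real" and \<mu> :: "real \<Rightarrow> 'v set \<Rightarrow> real"
  assumes fin: "finite V"
    and rate_nonneg: "j \<in> V \<Longrightarrow> 0 \<le> \<rho> j k"
    and nonneg: "0 \<le> t \<Longrightarrow> A \<subseteq> V \<Longrightarrow> 0 \<le> \<mu> t A"
    and init: "A \<subseteq> V \<Longrightarrow> \<mu> 0 A = (if A = {} then 1 else 0)"
    and total: "0 \<le> t \<Longrightarrow> (\<Sum>A\<in>Pow V. \<mu> t A) = 1"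
    and dynkin: "0 \<le> t \<Longrightarrow> ((\<lambda>t. \<Sum>A\<in>Pow V. \<mu> t A * g A) has_real_derivative
      (\<Sum>A\<in>Pow V. \<mu> t A * (\<Sum>j\<in>V - A. \<rho> j (card A) * (g (insert j A) - g A)))) (at t within {0..})"

definition adopters :: "nat \<Rightarrow> (nat \<Rightarrow> nat) \<Rightarrow> nat set" where
  "adopters M x = {j \<in> {1..M}. x j = 1}"

lemma adopters_subset: "adopters M x \<subseteq> {1..M}"
  by (auto simp: adopters_def)

lemma nonadopters_eq: "x \<in> bass_states M \<Longrightarrow> {1..M} - adopters M x = {j \<in> {1..M}. x j = 0}"
  by (auto simp: adopters_def bass_states_def PiE_iff)

lemma finite_bass_states: "finite (bass_states M)"
  unfolding bass_states_def by (intro finite_PiE) auto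

lemma sum_states_eq_card_adopters:
  assumes x: "x \<in> bass_states M"
  shows "(\<Sum>j=1..M. real (x j)) = real (card (adopters M x))"
proof -
  have "(\<Sum>j=1..M. real (x j)) = (\<Sum>j=1..M. if x j = 1 then 1 else 0)"
    using x by (intro sum.cong) (auto simp: bass_states_def PiE_iff)
  also have "\<dots> = real (card (adopters M x))"
    by (subst sum.inter_filter[symmetric]) (auto simp: adopters_def)
  finally show ?thesis .
qed

text \<open>Since the influence \<open>w j\<close> on \<open>j\<close> is the same from every node,
  the rate at which \<open>j\<close> adopts depends on the state only through the number of
  adopters. The generator therefore acts on functions of the adopter set.\<close>

lemma bass_generator:
  fixes g :: "nat set \<Rightarrow> real"
  assumes x: "x \<in> bass_states M"
  shows "(\<Sum>y\<in>bass_states M. bass_rate M p (\<lambda>i j. w j) x y * (g (adopters M y) - g (adopters M x)))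
    = (\<Sum>j\<in>{1..M} - adopters M x. (p j + w j * real (card (adopters M x))) *
        (g (insert j (adopters M x)) - g (adopters M x)))"
proof -
  let ?S = "bass_states M" and ?N = "{j \<in> {1..M}. x j = 0}"
  let ?R = "\<lambda>j. p j + w j * real (card (adopters M x))"
  let ?d = "\<lambda>y. g (adopters M y) - g (adopters M x)"
  have R: "p j + (\<Sum>k\<in>{1..M} - {j}. w j * real (x k)) = ?R j" if "j \<in> ?N" for j
  proof -
    \<comment> \<open>Including \<open>k = j\<close> is harmless, as \<open>x j = 0\<close> for a
      nonadopter.\<close>
    have "(\<Sum>k\<in>{1..M} - {j}. real (x k)) = (\<Sum>k=1..M. real (x k))"
      using that by (intro sum.mono_neutral_left) auto
    then show ?thesis
      using sum_states_eq_card_adopters[OF x] by (simp flip: sum_distrib_left)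
  qed
  \<comment> \<open>Written with the index set \<open>?N\<close> independent of \<open>y\<close>,
    the rate allows the sums over \<open>y\<close> and \<open>j\<close> to be exchanged; each
    \<open>j\<close> then selects one target state.\<close>
  have rate: "bass_rate M p (\<lambda>i j. w j) x y = (\<Sum>j\<in>?N. if y = x(j := 1) then ?R j else 0)" for y
  proof -
    have "bass_rate M p (\<lambda>i j. w j) x y = (\<Sum>j | j \<in> ?N \<and> y = x(j := 1). ?R j)"
      unfolding bass_rate_def by (rule sum.cong) (use R in auto)
    also have "\<dots> = (\<Sum>j\<in>?N. if y = x(j := 1) then ?R j else 0)"
      by (subst sum.inter_filter[symmetric]) auto
    finally show ?thesis .
  qed
  have upd: "x(j := 1) \<in> ?S" "adopters M (x(j := 1)) = insert j (adopters M x)" if "j \<in> ?N" for j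
    using x that by (auto simp: bass_states_def PiE_iff adopters_def extensional_def)
  have "(\<Sum>y\<in>?S. bass_rate M p (\<lambda>i j. w j) x y * ?d y)
      = (\<Sum>y\<in>?S. \<Sum>j\<in>?N. if y = x(j := 1) then ?R j * ?d y else 0)"
    unfolding rate sum_distrib_right by (intro sum.cong) auto
  also have "\<dots> = (\<Sum>j\<in>?N. \<Sum>y\<in>?S. if y = x(j := 1) then ?R j * ?d y else 0)"
    by (rule sum.swap)
  also have "\<dots> = (\<Sum>j\<in>?N. ?R j * (g (insert j (adopters M x)) - g (adopters M x)))"
  proof (rule sum.cong[OF refl])
    fix j assume j: "j \<in> ?N"
    show "(\<Sum>y\<in>?S. if y = x(j := 1) then ?R j * ?d y else 0)
      = ?R j * (g (insert j (adopters M x)) - g (adopters M x))"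
      using upd[OF j] finite_bass_states[of M] by (subst sum.delta) simp_all
  qed
  finally show ?thesis unfolding nonadopters_eq[OF x] .
qed

lemma (in prob_space) expectation_finite_range:
  fixes h :: "'b \<Rightarrow> real"
  assumes S: "finite S" and X: "X \<in> measurable M (count_space S)"
  shows "expectation (\<lambda>\<omega>. h (X \<omega>)) = (\<Sum>y\<in>S. prob {\<omega> \<in> space M. X \<omega> = y} * h y)"
proof -
  have sets: "{\<omega> \<in> space M. X \<omega> = y} \<in> events" if "y \<in> S" for y
  proof -
    have "X -` {y} \<inter> space M \<in> events"
      by (rule measurable_sets[OF X]) (use that in auto)
    also have "X -` {y} \<inter> space M = {\<omega> \<in> space M. X \<omega> = y}" by auto
    finally show ?thesis .
  qed
  have "expectation (\<lambda>\<omega>. h (X \<omega>)) = expectation (\<lambda>\<omega>. \<Sum>y\<in>S. indicator {\<omega> \<in> space M. X \<omega> = y} \<omega> * h y)"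
  proof (rule Bochner_Integration.integral_cong[OF refl])
    fix \<omega> assume \<omega>: "\<omega> \<in> space M"
    then have "X \<omega> \<in> S" using measurable_space[OF X] by auto
    have "(\<Sum>y\<in>S. indicator {\<omega> \<in> space M. X \<omega> = y} \<omega> * h y) = (\<Sum>y\<in>S. if X \<omega> = y then h y else 0)"
      using \<omega> by (intro sum.cong) auto
    then show "h (X \<omega>) = (\<Sum>y\<in>S. indicator {\<omega> \<in> space M. X \<omega> = y} \<omega> * h y)"
      using S \<open>X \<omega> \<in> S\<close> by simp
  qed
  also have "\<dots> = (\<Sum>y\<in>S. expectation (\<lambda>\<omega>. indicator {\<omega> \<in> space M. X \<omega> = y} \<omega> * h y))"
    by (rule Bochner_Integration.integral_sum) (use sets in \<open>auto intro!: integrable_mult_left integrable_real_indicator simp: emeasure_eq_measure\<close>)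
  also have "\<dots> = (\<Sum>y\<in>S. prob {\<omega> \<in> space M. X \<omega> = y} * h y)"
    using sets by (intro sum.cong) auto
  finally show ?thesis .
qed

text \<open>The law of the chain is pushed forward along \<open>adopters M\<close>; by
  \<open>bass_generator\<close> its forward equation closes on adopter sets. From here on only these
  sets matter.\<close>

lemma bass_process_set_growth:
  assumes X: "bass_process \<Omega> M p (\<lambda>i j. w j) X"
    and p: "\<And>j. j \<in> {1..M} \<Longrightarrow> 0 \<le> p j" and w: "\<And>j. j \<in> {1..M} \<Longrightarrow> 0 \<le> w j"
  shows "\<exists>\<mu>. set_growth {1..M} (\<lambda>j k. p j + w j * real k) \<mu> \<and>
    (\<forall>t\<ge>0. expected_adopter_fraction \<Omega> M X t = 1 / real M * (\<Sum>A\<in>Pow {1..M}. \<mu> t A * real (card A)))"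
proof -
  let ?S = "bass_states M"
  \<comment> \<open>Elements of \<open>bass_states M\<close> are extensional, so the initial state
    must be undefined outside the nodes.\<close>
  define x0 where "x0 = (\<lambda>j\<in>{1..M}. 0 :: nat)"
  have x0: "x0 \<in> ?S" by (auto simp: x0_def bass_states_def)
  have mc: "markov_chain \<Omega> ?S (bass_rate M p (\<lambda>i j. w j)) X"
    and AE0: "AE \<omega> in \<Omega>. \<forall>j\<in>{1..M}. X 0 \<omega> j = 0"
    using X unfolding bass_process_def by auto
  interpret prob_space \<Omega> using mc unfolding markov_chain_def by blast
  have meas: "X t \<in> measurable \<Omega> (count_space ?S)" if "0 \<le> t" for t
    using mc that unfolding markov_chain_def by blast
  have "AE \<omega> in \<Omega>. X 0 \<omega> = x0"
    using AE0
  proof (rule AE_mp, intro AE_I2 impI)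
    fix \<omega> assume "\<omega> \<in> space \<Omega>" and *: "\<forall>j\<in>{1..M}. X 0 \<omega> j = 0"
    then have "X 0 \<omega> \<in> ?S" using measurable_space[OF meas[of 0]] by auto
    then have "X 0 \<omega> \<in> extensional {1..M}" unfolding bass_states_def PiE_iff by blast
    then show "X 0 \<omega> = x0"
      by (rule extensionalityI[of _ "{1..M}"]) (use * in \<open>auto simp: x0_def\<close>)
  qed
  from markov_chain_law[OF mc x0 this] obtain P where
    P: "transition_function ?S (bass_rate M p (\<lambda>i j. w j)) P"
    and law: "\<And>t y. 0 \<le> t \<Longrightarrow> y \<in> ?S \<Longrightarrow> \<P>(\<omega> in \<Omega>. X t \<omega> = y) = P t x0 y"
    by blast
  define \<mu> where "\<mu> t A = (\<Sum>x | x \<in> ?S \<and> adopters M x = A. P t x0 x)" for t A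
  \<comment> \<open>Grouping states by adopter set carries every sum over sets back to a sum over
    states, where the facts about \<open>P\<close> apply.\<close>
  have \<mu>_sum: "(\<Sum>A\<in>Pow {1..M}. \<mu> t A * g A) = (\<Sum>x\<in>?S. P t x0 x * g (adopters M x))" for t and g :: "_ \<Rightarrow> real"
  proof -
    have "(\<Sum>A\<in>Pow {1..M}. \<mu> t A * g A)
      = (\<Sum>A\<in>Pow {1..M}. \<Sum>x | x \<in> ?S \<and> adopters M x = A. P t x0 x * g (adopters M x))"
      unfolding \<mu>_def sum_distrib_right by (intro sum.cong) auto
    also have "\<dots> = (\<Sum>x\<in>?S. P t x0 x * g (adopters M x))"
      by (rule sum.group) (use adopters_subset finite_bass_states in auto)
    finally show ?thesis .
  qed
  show ?thesis
  proof (intro exI[of _ \<mu>] conjI allI impI)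
    show "set_growth {1..M} (\<lambda>j k. p j + w j * real k) \<mu>"
    proof
      show "finite {1..M}" by simp
      show "0 \<le> p j + w j * real k" if "j \<in> {1..M}" for j k
        using p[OF that] w[OF that] by simp
      show "0 \<le> \<mu> t A" if "0 \<le> t" for t A
        unfolding \<mu>_def using transition_functionD(1)[OF P that x0] by (intro sum_nonneg) auto
      show "(\<Sum>A\<in>Pow {1..M}. \<mu> t A) = 1" if "0 \<le> t" for t
        using \<mu>_sum[of t "\<lambda>_. 1"] transition_functionD(2)[OF P that x0] by simp
      show "\<mu> 0 A = (if A = {} then 1 else 0)" for A
      proof -
        have "\<mu> 0 A = (\<Sum>x | x \<in> ?S \<and> adopters M x = A. if x = x0 then 1 else 0)"
          unfolding \<mu>_def using transition_functionD(3)[OF P x0] by (intro sum.cong) auto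
        moreover have "adopters M x0 = {}" by (auto simp: adopters_def x0_def)
        ultimately show ?thesis using x0 finite_bass_states[of M] by auto
      qed
      show "((\<lambda>t. \<Sum>A\<in>Pow {1..M}. \<mu> t A * g A) has_real_derivative
        (\<Sum>A\<in>Pow {1..M}. \<mu> t A * (\<Sum>j\<in>{1..M} - A. (p j + w j * real (card A)) * (g (insert j A) - g A))))
        (at t within {0..})" if "0 \<le> t" for t and g :: "_ \<Rightarrow> real"
        unfolding \<mu>_sum
        using transition_function_has_derivative[OF P finite_bass_states x0 that, of "\<lambda>x. g (adopters M x)"]
        by (simp only: bass_generator cong: sum.cong)
    qed
    show "expected_adopter_fraction \<Omega> M X t = 1 / real M * (\<Sum>A\<in>Pow {1..M}. \<mu> t A * real (card A))"
      if t: "0 \<le> t" for t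
    proof -
      have "expectation (\<lambda>\<omega>. \<Sum>j=1..M. real (X t \<omega> j))
          = (\<Sum>x\<in>?S. prob {\<omega> \<in> space \<Omega>. X t \<omega> = x} * (\<Sum>j=1..M. real (x j)))"
        by (rule expectation_finite_range[OF finite_bass_states meas[OF t]])
      also have "\<dots> = (\<Sum>x\<in>?S. P t x0 x * real (card (adopters M x)))"
        by (intro sum.cong refl) (simp only: law[OF t] sum_states_eq_card_adopters)
      finally show ?thesis
        unfolding expected_adopter_fraction_def \<mu>_sum by (simp only:)
    qed
  qed
qed

section \<open>Chebyshev bound for the adoption rate\<close>

text \<open>The identity behind Chebyshev's sum inequality; as an equation it serves both the weak
  and the strict version.\<close>

lemma sum_diff_mult_sum_diff:
  fixes w v :: "'a \<Rightarrow> real"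
  shows "(\<Sum>i\<in>V. \<Sum>j\<in>V. (w i - w j) * (v i - v j))
    = 2 * (real (card V) * (\<Sum>i\<in>V. w i * v i) - (\<Sum>i\<in>V. w i) * (\<Sum>i\<in>V. v i))"
proof -
  have "(\<Sum>i\<in>V. \<Sum>j\<in>V. w i * v i) = real (card V) * (\<Sum>i\<in>V. w i * v i)"
    "(\<Sum>i\<in>V. \<Sum>j\<in>V. w j * v j) = real (card V) * (\<Sum>i\<in>V. w i * v i)"
    by (simp_all add: sum_distrib_left)
  moreover have "(\<Sum>i\<in>V. \<Sum>j\<in>V. w i * v j) = (\<Sum>i\<in>V. w i) * (\<Sum>i\<in>V. v i)"
    by (rule sum_product[symmetric])
  moreover have "(\<Sum>i\<in>V. \<Sum>j\<in>V. w j * v i) = (\<Sum>i\<in>V. w i) * (\<Sum>i\<in>V. v i)"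
    by (subst sum.swap) (rule sum_product[symmetric])
  moreover have "(w i - w j) * (v i - v j) = w i * v i - w i * v j - w j * v i + w j * v j" for i j
    by (simp add: algebra_simps)
  ultimately have "(\<Sum>i\<in>V. \<Sum>j\<in>V. (w i - w j) * (v i - v j))
    = real (card V) * (\<Sum>i\<in>V. w i * v i) - (\<Sum>i\<in>V. w i) * (\<Sum>i\<in>V. v i)
      - (\<Sum>i\<in>V. w i) * (\<Sum>i\<in>V. v i) + real (card V) * (\<Sum>i\<in>V. w i * v i)"
    by (simp only: sum.distrib sum_subtractf)
  also have "a - b - b + a = 2 * (a - b)" for a b :: real by simp
  finally show ?thesis .
qed

text \<open>Similar ordering is expressed by the signs of products of differences, so the index type
  carries no order.\<close>

lemma Chebyshev_sum_le:
  fixes w v :: "'a \<Rightarrow> real"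
  assumes "\<And>i j. i \<in> V \<Longrightarrow> j \<in> V \<Longrightarrow> 0 \<le> (w i - w j) * (v i - v j)"
  shows "(\<Sum>i\<in>V. w i) * (\<Sum>i\<in>V. v i) \<le> real (card V) * (\<Sum>i\<in>V. w i * v i)"
proof -
  have "0 \<le> (\<Sum>i\<in>V. \<Sum>j\<in>V. (w i - w j) * (v i - v j))"
    using assms by (intro sum_nonneg)
  then show ?thesis unfolding sum_diff_mult_sum_diff by simp
qed

text \<open>A single positive term in the nonnegative double sum suffices for strictness.\<close>

lemma Chebyshev_sum_less:
  fixes w v :: "'a \<Rightarrow> real"
  assumes "finite V" and *: "\<And>i j. i \<in> V \<Longrightarrow> j \<in> V \<Longrightarrow> 0 \<le> (w i - w j) * (v i - v j)"
    and ab: "a \<in> V" "b \<in> V" "0 < (w a - w b) * (v a - v b)"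
  shows "(\<Sum>i\<in>V. w i) * (\<Sum>i\<in>V. v i) < real (card V) * (\<Sum>i\<in>V. w i * v i)"
proof -
  have "0 < (\<Sum>j\<in>V. (w a - w j) * (v a - v j))"
    using assms(1) ab(2,3) *[OF ab(1)] by (rule sum_pos2)
  then have "0 < (\<Sum>i\<in>V. \<Sum>j\<in>V. (w i - w j) * (v i - v j))"
    by (rule sum_pos2[OF assms(1) ab(1)]) (rule sum_nonneg, rule *)
  then show ?thesis unfolding sum_diff_mult_sum_diff by simp
qed

section \<open>Masses and flows sorted by the number of adopters\<close>

definition tail_mass :: "'v set \<Rightarrow> ('v set \<Rightarrow> real) \<Rightarrow> nat \<Rightarrow> real" where
  "tail_mass V m k = (\<Sum>A\<in>Pow V. m A * of_bool (k \<le> card A))"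

definition level_mass :: "'v set \<Rightarrow> ('v set \<Rightarrow> real) \<Rightarrow> nat \<Rightarrow> real" where
  "level_mass V m k = (\<Sum>A\<in>Pow V. m A * of_bool (card A = k))"

text \<open>As a function of \<open>j\<close>, this is the weight that Chebyshev's inequality pairs
  with the rates \<open>\<rho> j k\<close>.\<close>

definition member_mass :: "'v set \<Rightarrow> ('v set \<Rightarrow> real) \<Rightarrow> nat \<Rightarrow> 'v \<Rightarrow> real" where
  "member_mass V m k j = (\<Sum>A | A \<subseteq> V \<and> card A = k \<and> j \<in> A. m A)"

text \<open>The probability current from sets of size \<open>k\<close> to sets of size
  \<open>k + 1\<close>, that is, the growth speed of the tail at \<open>Suc k\<close>; see
  \<open>tail_mass_has_derivative\<close>.\<close>

definition outflow :: "'v set \<Rightarrow> ('v \<Rightarrow> nat \<Rightarrow> real) \<Rightarrow> ('v set \<Rightarrow> real) \<Rightarrow> nat \<Rightarrow> real" where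
  "outflow V \<rho> m k = (\<Sum>A\<in>Pow V. m A * (of_bool (card A = k) * (\<Sum>j\<in>V - A. \<rho> j k)))"

definition mean_rate :: "'v set \<Rightarrow> ('v \<Rightarrow> nat \<Rightarrow> real) \<Rightarrow> nat \<Rightarrow> real" where
  "mean_rate V \<rho> k = (\<Sum>j\<in>V. \<rho> j k) / real (card V)"

lemma tail_mass_Suc: "tail_mass V m k = tail_mass V m (Suc k) + level_mass V m k"
  unfolding tail_mass_def level_mass_def sum.distrib[symmetric]
  by (intro sum.cong) auto

text \<open>Layer-cake formula: a cardinality counts the thresholds \<open>k \<ge> 1\<close> that it
  reaches.\<close>

lemma sum_card_eq_sum_tail_mass:
  assumes "finite V"
  shows "(\<Sum>A\<in>Pow V. m A * real (card A)) = (\<Sum>k=1..card V. tail_mass V m k)"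
proof -
  have "real (card A) = (\<Sum>k=1..card V. of_bool (k \<le> card A))" if "A \<in> Pow V" for A
  proof -
    have "card A \<le> card V" using that assms by (auto intro: card_mono)
    then have "{k \<in> {1..card V}. k \<le> card A} = {1..card A}" by auto
    then show ?thesis by (simp add: of_bool_def sum.inter_filter[symmetric])
  qed
  then have "(\<Sum>A\<in>Pow V. m A * real (card A)) = (\<Sum>A\<in>Pow V. \<Sum>k=1..card V. m A * of_bool (k \<le> card A))"
    by (intro sum.cong) (simp_all only: sum_distrib_left)
  then show ?thesis unfolding tail_mass_def by (subst sum.swap) simp
qed

text \<open>Double counting of the pairs of a set of size \<open>k\<close> and an element of
  it.\<close>

lemma sum_member_mass:
  assumes "finite V"
  shows "(\<Sum>j\<in>V. w j * member_mass V m k j) = (\<Sum>A\<in>Pow V. m A * (of_bool (card A = k) * (\<Sum>j\<in>A. w j)))"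
proof -
  have "(\<Sum>j\<in>V. w j * member_mass V m k j)
    = (\<Sum>j\<in>V. \<Sum>A\<in>Pow V. if card A = k \<and> j \<in> A then w j * m A else 0)"
  proof (rule sum.cong[OF refl])
    fix j
    have "{A. A \<subseteq> V \<and> card A = k \<and> j \<in> A} = {A \<in> Pow V. card A = k \<and> j \<in> A}" by auto
    then show "w j * member_mass V m k j = (\<Sum>A\<in>Pow V. if card A = k \<and> j \<in> A then w j * m A else 0)"
      using assms by (simp only: member_mass_def sum_distrib_left sum.inter_filter finite_Pow_iff)
         (intro sum.cong refl, simp)
  qed
  also have "\<dots> = (\<Sum>A\<in>Pow V. \<Sum>j\<in>V. if card A = k \<and> j \<in> A then w j * m A else 0)"
    by (rule sum.swap)
  also have "\<dots> = (\<Sum>A\<in>Pow V. m A * (of_bool (card A = k) * (\<Sum>j\<in>A. w j)))"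
  proof (rule sum.cong[OF refl])
    fix A assume "A \<in> Pow V"
    then have "{j \<in> V. j \<in> A} = A" by auto
    then show "(\<Sum>j\<in>V. if card A = k \<and> j \<in> A then w j * m A else 0)
      = m A * (of_bool (card A = k) * (\<Sum>j\<in>A. w j))"
      using assms sum.inter_filter[of V "\<lambda>j. w j * m A" "\<lambda>j. j \<in> A"]
      by (cases "card A = k") (simp_all add: sum_distrib_left mult.commute)
  qed
  finally show ?thesis .
qed

text \<open>The sum over nonadopters is the sum over all nodes minus that over adopters. A lower
  bound for the latter, as Chebyshev gives, thus bounds the outflow from above.\<close>

lemma outflow_eq:
  assumes "finite V"
  shows "outflow V \<rho> m k = (\<Sum>j\<in>V. \<rho> j k) * level_mass V m k - (\<Sum>j\<in>V. \<rho> j k * member_mass V m k j)"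
proof -
  have "outflow V \<rho> m k = (\<Sum>A\<in>Pow V. (\<Sum>j\<in>V. \<rho> j k) * (m A * of_bool (card A = k))
      - m A * (of_bool (card A = k) * (\<Sum>j\<in>A. \<rho> j k)))"
    unfolding outflow_def using assms
    by (intro sum.cong refl) (auto simp: sum_diff algebra_simps)
  then show ?thesis
    unfolding sum_member_mass[OF assms] level_mass_def by (simp only: sum_subtractf sum_distrib_left)
qed

lemma sum_member_mass_1:
  assumes "finite V"
  shows "(\<Sum>j\<in>V. member_mass V m k j) = real k * level_mass V m k"
proof -
  have "(\<Sum>j\<in>V. member_mass V m k j) = (\<Sum>A\<in>Pow V. m A * (of_bool (card A = k) * (\<Sum>j\<in>A. 1)))"
    using sum_member_mass[OF assms, of "\<lambda>_. 1" m k] by (simp only: mult_1)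
  also have "\<dots> = (\<Sum>A\<in>Pow V. real k * (m A * of_bool (card A = k)))"
    by (intro sum.cong) auto
  finally show ?thesis unfolding level_mass_def by (simp only: sum_distrib_left)
qed

text \<open>The equality case of \<open>outflow_le\<close>, which describes the homogeneous
  network.\<close>

lemma outflow_const:
  assumes "finite V"
  shows "outflow V (\<lambda>j. r) m k = (real (card V) - real k) * r k * level_mass V m k"
  unfolding outflow_eq[OF assms]
  by (simp add: sum_member_mass_1[OF assms] algebra_simps flip: sum_distrib_left)

text \<open>Chebyshev applied to the rates and the member masses, whose total is
  \<open>real k * level_mass V m k\<close>: adopters are on average at least as fast as a typical
  node, so nonadopters are at most as fast.\<close>

lemma outflow_le:
  assumes "finite V" "V \<noteq> {}"
    and "\<And>i j. i \<in> V \<Longrightarrow> j \<in> V \<Longrightarrow> 0 \<le> (\<rho> i k - \<rho> j k) * (member_mass V m k i - member_mass V m k j)"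
  shows "outflow V \<rho> m k \<le> (real (card V) - real k) * mean_rate V \<rho> k * level_mass V m k"
proof -
  have N: "0 < real (card V)" using assms by (simp add: card_gt_0_iff)
  have "(\<Sum>j\<in>V. \<rho> j k) * (real k * level_mass V m k) \<le> real (card V) * (\<Sum>j\<in>V. \<rho> j k * member_mass V m k j)"
    using Chebyshev_sum_le[of V "\<lambda>j. \<rho> j k" "member_mass V m k"] assms(3)
    unfolding sum_member_mass_1[OF assms(1)] by blast
  then show ?thesis
    using N unfolding outflow_eq[OF assms(1)] mean_rate_def by (simp add: field_simps)
qed

lemma outflow_less:
  assumes "finite V" "V \<noteq> {}"
    and "\<And>i j. i \<in> V \<Longrightarrow> j \<in> V \<Longrightarrow> 0 \<le> (\<rho> i k - \<rho> j k) * (member_mass V m k i - member_mass V m k j)"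
    and "a \<in> V" "b \<in> V" "0 < (\<rho> a k - \<rho> b k) * (member_mass V m k a - member_mass V m k b)"
  shows "outflow V \<rho> m k < (real (card V) - real k) * mean_rate V \<rho> k * level_mass V m k"
proof -
  have N: "0 < real (card V)" using assms by (simp add: card_gt_0_iff)
  have "(\<Sum>j\<in>V. \<rho> j k) * (real k * level_mass V m k) < real (card V) * (\<Sum>j\<in>V. \<rho> j k * member_mass V m k j)"
    using Chebyshev_sum_less[of V "\<lambda>j. \<rho> j k" "member_mass V m k" a b] assms
    unfolding sum_member_mass_1[OF assms(1)] by blast
  then show ?thesis
    using N unfolding outflow_eq[OF assms(1)] mean_rate_def by (simp add: field_simps)
qed

text \<open>Sets containing both \<open>i\<close> and \<open>j\<close> contribute equally to both
  member masses, so comparing these masses reduces to comparing \<open>insert i B\<close> with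
  \<open>insert j B\<close>. The form \<open>Suc (card B) = k\<close> avoids truncated subtraction
  at \<open>k = 0\<close>.\<close>

lemma member_mass_split:
  assumes "finite V" and ij: "i \<in> V" "j \<in> V" "i \<noteq> j"
  shows "member_mass V m k j = (\<Sum>B | B \<subseteq> V - {i, j} \<and> Suc (card B) = k. m (insert j B))
    + (\<Sum>A | A \<subseteq> V \<and> card A = k \<and> i \<in> A \<and> j \<in> A. m A)"
proof -
  let ?U = "{B. B \<subseteq> V - {i, j} \<and> Suc (card B) = k}"
  let ?W = "{A. A \<subseteq> V \<and> card A = k \<and> i \<in> A \<and> j \<in> A}"
  have fin: "finite B" if "B \<subseteq> V - {i, j}" for B
    using that assms(1) by (auto intro: finite_subset)
  have fin2: "finite ?U" "finite ?W" using assms(1) by (auto intro: finite_subset[of _ "Pow V"])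
  have "{A. A \<subseteq> V \<and> card A = k \<and> j \<in> A} = insert j ` ?U \<union> ?W"
  proof (intro equalityI subsetI)
    fix A assume "A \<in> {A. A \<subseteq> V \<and> card A = k \<and> j \<in> A}"
    then have A: "A \<subseteq> V" "card A = k" "j \<in> A" by auto
    show "A \<in> insert j ` ?U \<union> ?W"
    proof (cases "i \<in> A")
      case False
      have "finite A" using A assms(1) finite_subset by blast
      then have "Suc (card (A - {j})) = k" using A by (metis card_Suc_Diff1)
      then have "A - {j} \<in> ?U" using A False by auto
      moreover have "A = insert j (A - {j})" using A by auto
      ultimately show ?thesis by blast
    qed (use A in auto)
  next
    fix A assume "A \<in> insert j ` ?U \<union> ?W"
    then show "A \<in> {A. A \<subseteq> V \<and> card A = k \<and> j \<in> A}"
    proof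
      assume "A \<in> insert j ` ?U"
      then obtain B where B: "B \<subseteq> V - {i, j}" "Suc (card B) = k" "A = insert j B" by auto
      then have "card A = k" using fin[OF B(1)] by (subst B(3), subst card_insert_disjoint) auto
      then show ?thesis using B ij by auto
    qed auto
  qed
  moreover have "insert j ` ?U \<inter> ?W = {}" using ij by auto
  moreover have "inj_on (insert j) ?U"
    by (rule inj_on_inverseI[of _ "\<lambda>A. A - {j}"]) auto
  ultimately show ?thesis
    unfolding member_mass_def using fin2 by (simp add: sum.union_disjoint sum.reindex)
qed

lemma member_mass_singleton:
  assumes "finite V" "j \<in> V"
  shows "member_mass V m 1 j = m {j}"
proof -
  have "{A. A \<subseteq> V \<and> card A = 1 \<and> j \<in> A} = {{j}}"
    using assms by (auto simp: card_1_singleton_iff)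
  then show ?thesis unfolding member_mass_def by simp
qed

section \<open>Comparison with the homogeneous network\<close>

text \<open>Integrating factor: \<open>exp (c * s) * D s\<close> has derivative
  \<open>exp (c * s) * (D' s + c * D s)\<close>.\<close>

lemma exp_mult_mono:
  fixes D :: "real \<Rightarrow> real"
  assumes D: "\<And>s. 0 \<le> s \<Longrightarrow> (D has_real_derivative D' s) (at s within {0..})"
    and nonneg: "\<And>s. 0 \<le> s \<Longrightarrow> 0 \<le> D' s + c * D s" and t: "0 \<le> t"
  shows "D 0 \<le> exp (c * t) * D t"
proof -
  have deriv: "((\<lambda>s. exp (c * s) * D s) has_real_derivative exp (c * s) * (D' s + c * D s)) (at s within {0..})"
    if "0 \<le> s" for s
    by (auto intro!: derivative_eq_intros D that simp: algebra_simps)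
  have "(\<lambda>s. exp (c * s) * D s) 0 \<le> (\<lambda>s. exp (c * s) * D s) t"
  proof (rule DERIV_nonneg_imp_increasing_open[OF t])
    fix s assume "0 < s" "s < t"
    then show "\<exists>y. ((\<lambda>s. exp (c * s) * D s) has_real_derivative y) (at s) \<and> 0 \<le> y"
      using deriv[of s] nonneg[of s] at_within_interior[of s "{0..}"]
      by (intro exI[of _ "exp (c * s) * (D' s + c * D s)"]) auto
  next
    show "continuous_on {0..t} (\<lambda>s. exp (c * s) * D s)"
      by (rule continuous_on_subset[OF DERIV_continuous_on[OF deriv]]) auto
  qed
  then show ?thesis by simp
qed

text \<open>Positivity is asked only for \<open>s > 0\<close>: in the final comparison the
  expression vanishes at time 0, when all mass sits on the empty set.\<close>

lemma exp_mult_strict_mono: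
  fixes D :: "real \<Rightarrow> real"
  assumes D: "\<And>s. 0 \<le> s \<Longrightarrow> (D has_real_derivative D' s) (at s within {0..})"
    and pos: "\<And>s. 0 < s \<Longrightarrow> 0 < D' s + c * D s" and t: "0 < t"
  shows "D 0 < exp (c * t) * D t"
proof -
  have deriv: "((\<lambda>s. exp (c * s) * D s) has_real_derivative exp (c * s) * (D' s + c * D s)) (at s within {0..})"
    if "0 \<le> s" for s
    by (auto intro!: derivative_eq_intros D that simp: algebra_simps)
  have "(\<lambda>s. exp (c * s) * D s) 0 < (\<lambda>s. exp (c * s) * D s) t"
  proof (rule DERIV_pos_imp_increasing_open[OF t])
    fix s assume "0 < s" "s < t"
    then show "\<exists>y. ((\<lambda>s. exp (c * s) * D s) has_real_derivative y) (at s) \<and> 0 < y"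
      using deriv[of s] pos[of s] at_within_interior[of s "{0..}"]
      by (intro exI[of _ "exp (c * s) * (D' s + c * D s)"]) auto
  next
    show "continuous_on {0..t} (\<lambda>s. exp (c * s) * D s)"
      by (rule continuous_on_subset[OF DERIV_continuous_on[OF deriv]]) auto
  qed
  then show ?thesis by simp
qed

section \<open>Forward equations and the exchange of a slower for a faster adopter\<close>

context set_growth
begin

text \<open>\<open>dynkin\<close> for the indicator of \<open>B\<close>: the process enters
  \<open>B\<close> from some \<open>B - {l}\<close> and leaves it through a node outside. The
  truncated \<open>card B - 1\<close> is exact wherever it counts, since the first sum is empty for
  \<open>B = {}\<close>.\<close>

lemma forward_equation:
  assumes t: "0 \<le> t" and B: "B \<subseteq> V"
  shows "((\<lambda>t. \<mu> t B) has_real_derivative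
    (\<Sum>l\<in>B. \<rho> l (card B - 1) * \<mu> t (B - {l})) - (\<Sum>l\<in>V - B. \<rho> l (card B)) * \<mu> t B) (at t within {0..})"
proof -
  have fB: "finite B" using B fin finite_subset by blast
  have *: "(\<Sum>A\<in>Pow V. m A * of_bool (A = B)) = m B" for m :: "_ \<Rightarrow> real"
    using B fin by (simp add: of_bool_def if_distrib cong: if_cong)
  have split: "(\<Sum>j\<in>V - A. \<rho> j (card A) * (of_bool (insert j A = B) - of_bool (A = B)))
    = (\<Sum>j\<in>V. if j \<in> B \<and> A = B - {j} then \<rho> j (card B - 1) else 0) - (\<Sum>j\<in>V - A. \<rho> j (card A)) * of_bool (A = B)"
    if A: "A \<in> Pow V" for A
  proof -
    have "(\<Sum>j\<in>V. if j \<in> B \<and> A = B - {j} then \<rho> j (card B - 1) else 0)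
      = (\<Sum>j\<in>V - A. if j \<in> B \<and> A = B - {j} then \<rho> j (card B - 1) else 0)"
      using fin by (intro sum.mono_neutral_right) auto
    also have "\<dots> = (\<Sum>j\<in>V - A. \<rho> j (card A) * of_bool (insert j A = B))"
      using fB by (intro sum.cong refl) (auto simp: of_bool_def)
    finally show ?thesis
      by (simp only: right_diff_distrib sum_subtractf sum_distrib_right)
  qed
  have "(\<Sum>A\<in>Pow V. \<mu> t A * (\<Sum>j\<in>V - A. \<rho> j (card A) * (of_bool (insert j A = B) - of_bool (A = B))))
    = (\<Sum>A\<in>Pow V. \<Sum>j\<in>V. if j \<in> B \<and> A = B - {j} then \<mu> t A * \<rho> j (card B - 1) else 0)
      - (\<Sum>A\<in>Pow V. (\<mu> t A * (\<Sum>j\<in>V - A. \<rho> j (card A))) * of_bool (A = B))"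
    unfolding sum_subtractf[symmetric]
  proof (rule sum.cong[OF refl])
    fix A assume "A \<in> Pow V"
    have "(\<Sum>j\<in>V. if j \<in> B \<and> A = B - {j} then \<mu> t A * \<rho> j (card B - 1) else 0)
      = \<mu> t A * (\<Sum>j\<in>V. if j \<in> B \<and> A = B - {j} then \<rho> j (card B - 1) else 0)"
      unfolding sum_distrib_left by (intro sum.cong) auto
    then show "\<mu> t A * (\<Sum>j\<in>V - A. \<rho> j (card A) * (of_bool (insert j A = B) - of_bool (A = B)))
      = (\<Sum>j\<in>V. if j \<in> B \<and> A = B - {j} then \<mu> t A * \<rho> j (card B - 1) else 0)
        - \<mu> t A * (\<Sum>j\<in>V - A. \<rho> j (card A)) * of_bool (A = B)"
      unfolding split[OF \<open>A \<in> Pow V\<close>] by (simp only: right_diff_distrib mult.assoc)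
  qed
  also have "(\<Sum>A\<in>Pow V. \<Sum>j\<in>V. if j \<in> B \<and> A = B - {j} then \<mu> t A * \<rho> j (card B - 1) else 0)
    = (\<Sum>j\<in>V. \<Sum>A\<in>Pow V. if j \<in> B \<and> A = B - {j} then \<mu> t A * \<rho> j (card B - 1) else 0)"
    by (rule sum.swap)
  also have "\<dots> = (\<Sum>j\<in>V. if j \<in> B then \<rho> j (card B - 1) * \<mu> t (B - {j}) else 0)"
  proof (rule sum.cong[OF refl])
    fix j
    have "B - {j} \<in> Pow V" using B by auto
    then show "(\<Sum>A\<in>Pow V. if j \<in> B \<and> A = B - {j} then \<mu> t A * \<rho> j (card B - 1) else 0)
      = (if j \<in> B then \<rho> j (card B - 1) * \<mu> t (B - {j}) else 0)"
      using fin by (cases "j \<in> B") (simp_all add: mult.commute)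
  qed
  also have "\<dots> = (\<Sum>j\<in>B. \<rho> j (card B - 1) * \<mu> t (B - {j}))"
  proof -
    have "{j \<in> V. j \<in> B} = B" using B by auto
    then show ?thesis
      using sum.inter_filter[OF fin, of "\<lambda>j. \<rho> j (card B - 1) * \<mu> t (B - {j})" "\<lambda>j. j \<in> B"] by simp
  qed
  finally show ?thesis
    using dynkin[OF t, of "\<lambda>A. of_bool (A = B)"] unfolding * by (simp only: mult.commute)
qed

text \<open>The empty set has no gain term, so its mass only decays exponentially.\<close>

lemma empty_pos:
  assumes t: "0 \<le> t"
  shows "0 < \<mu> t {}"
proof -
  define c where "c = (\<Sum>l\<in>V. \<rho> l 0)"
  have "\<mu> 0 {} \<le> exp (c * t) * \<mu> t {}"
    by (rule exp_mult_mono[OF forward_equation]) (use t in \<open>auto simp: c_def\<close>)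
  then have "0 < exp (c * t) * \<mu> t {}" using init[of "{}"] by simp
  then show ?thesis by (simp add: zero_less_mult_iff)
qed

text \<open>The loss rates of \<open>insert i B\<close> and \<open>insert j B\<close> differ by
  \<open>\<rho> j - \<rho> i\<close> at level \<open>Suc (card B)\<close>. Using one of them as
  common coefficient turns this difference into a source term with the sign of
  \<open>\<rho> j - \<rho> i\<close>.\<close>

lemma exchange_equation:
  assumes t: "0 \<le> t" and ij: "i \<in> V" "j \<in> V" "i \<noteq> j" and B: "B \<subseteq> V - {i, j}"
  shows "((\<lambda>t. \<mu> t (insert j B) - \<mu> t (insert i B)) has_real_derivative
    ((\<rho> j (card B) - \<rho> i (card B)) * \<mu> t B
     + (\<Sum>l\<in>B. \<rho> l (card B) * (\<mu> t (insert j (B - {l})) - \<mu> t (insert i (B - {l}))))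
     + (\<rho> j (Suc (card B)) - \<rho> i (Suc (card B))) * \<mu> t (insert i B))
    - (\<Sum>l\<in>V - insert j B. \<rho> l (Suc (card B))) * (\<mu> t (insert j B) - \<mu> t (insert i B))) (at t within {0..})"
proof -
  define k where "k = card B"
  have fB: "finite B" using B fin finite_subset by blast
  \<comment> \<open>Removing \<open>u\<close> leaves \<open>B\<close>; removing any other
    \<open>l\<close> leaves the same configuration over the smaller set \<open>B - {l}\<close>,
    which makes the induction in \<open>exchange_le\<close> possible.\<close>
  have gain: "(\<Sum>l\<in>insert u B. \<rho> l (Suc k - 1) * \<mu> t (insert u B - {l}))
    = \<rho> u k * \<mu> t B + (\<Sum>l\<in>B. \<rho> l k * \<mu> t (insert u (B - {l})))" if "u \<notin> B" for u
  proof -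
    have "(\<Sum>l\<in>B. \<rho> l k * \<mu> t (insert u B - {l})) = (\<Sum>l\<in>B. \<rho> l k * \<mu> t (insert u (B - {l})))"
      using that by (intro sum.cong refl) (metis insert_Diff_if singletonD)
    then show ?thesis using that fB by (simp add: k_def)
  qed
  have nin: "i \<notin> B" "j \<notin> B" using B by auto
  then have card: "card (insert i B) = Suc k" "card (insert j B) = Suc k"
    using fB by (simp_all add: k_def)
  \<comment> \<open>\<open>R\<close> consists of the nodes outside both sets, so the two complements
    differ only in \<open>i\<close> and \<open>j\<close>.\<close>
  define R where "R = V - {i, j} - B"
  have "V - insert i B = insert j R" "V - insert j B = insert i R" "finite R" "i \<notin> R" "j \<notin> R"
    using ij nin fin by (auto simp: R_def)
  then have loss: "(\<Sum>l\<in>V - insert i B. \<rho> l (Suc k))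
      = (\<Sum>l\<in>V - insert j B. \<rho> l (Suc k)) + \<rho> j (Suc k) - \<rho> i (Suc k)"
    by simp
  have sub: "insert i B \<subseteq> V" "insert j B \<subseteq> V" using ij B by auto
  have "(\<Sum>l\<in>B. \<rho> l k * (\<mu> t (insert j (B - {l})) - \<mu> t (insert i (B - {l}))))
    = (\<Sum>l\<in>B. \<rho> l k * \<mu> t (insert j (B - {l}))) - (\<Sum>l\<in>B. \<rho> l k * \<mu> t (insert i (B - {l})))"
    by (simp only: right_diff_distrib sum_subtractf)
  then show ?thesis
    by (intro DERIV_cong[OF DERIV_diff[OF forward_equation[OF t sub(2)] forward_equation[OF t sub(1)]]])
       (simp only: gain[OF nin(1)] gain[OF nin(2)] card loss k_def[symmetric], simp add: algebra_simps)
qed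

lemma exchange_le:
  assumes ij: "i \<in> V" "j \<in> V" "i \<noteq> j" and le: "\<And>k. \<rho> i k \<le> \<rho> j k"
    and B: "B \<subseteq> V - {i, j}" and t: "0 \<le> t"
  shows "\<mu> t (insert i B) \<le> \<mu> t (insert j B)"
  using B t
proof (induction "card B" arbitrary: B t rule: less_induct)
  case less
  have fB: "finite B" using less.prems fin finite_subset by blast
  \<comment> \<open>This \<open>c\<close> cancels the loss term exactly, leaving three nonnegative
    sources; the middle one is nonnegative by the induction hypothesis for
    \<open>B - {l}\<close>.\<close>
  define c where "c = (\<Sum>l\<in>V - insert j B. \<rho> l (Suc (card B)))"
  have "(\<lambda>t. \<mu> t (insert j B) - \<mu> t (insert i B)) 0 \<le> exp (c * t) * (\<mu> t (insert j B) - \<mu> t (insert i B))"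
  proof (rule exp_mult_mono[OF exchange_equation[OF _ ij less.prems(1)] _ less.prems(2)])
    fix s :: real assume s: "0 \<le> s"
    have "0 \<le> \<rho> l (card B) * (\<mu> s (insert j (B - {l})) - \<mu> s (insert i (B - {l})))" if "l \<in> B" for l
    proof -
      have "\<mu> s (insert i (B - {l})) \<le> \<mu> s (insert j (B - {l}))"
        by (rule less.hyps[OF card_Diff1_less[OF fB that] _ s]) (use less.prems in auto)
      moreover have "l \<in> V" using that less.prems by auto
      ultimately show ?thesis using rate_nonneg by simp
    qed
    then have "0 \<le> (\<Sum>l\<in>B. \<rho> l (card B) * (\<mu> s (insert j (B - {l})) - \<mu> s (insert i (B - {l}))))"
      by (rule sum_nonneg)
    moreover have "0 \<le> (\<rho> j (card B) - \<rho> i (card B)) * \<mu> s B"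
      "0 \<le> (\<rho> j (Suc (card B)) - \<rho> i (Suc (card B))) * \<mu> s (insert i B)"
      by (rule mult_nonneg_nonneg; use le nonneg[OF s, of B] nonneg[OF s, of "insert i B"] less.prems ij in auto)+
    ultimately show "0 \<le> ((\<rho> j (card B) - \<rho> i (card B)) * \<mu> s B
     + (\<Sum>l\<in>B. \<rho> l (card B) * (\<mu> s (insert j (B - {l})) - \<mu> s (insert i (B - {l}))))
     + (\<rho> j (Suc (card B)) - \<rho> i (Suc (card B))) * \<mu> s (insert i B))
    - (\<Sum>l\<in>V - insert j B. \<rho> l (Suc (card B))) * (\<mu> s (insert j B) - \<mu> s (insert i B))
    + c * (\<mu> s (insert j B) - \<mu> s (insert i B))"
      unfolding c_def by simp
  qed
  moreover have "\<mu> 0 (insert j B) = 0" "\<mu> 0 (insert i B) = 0"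
    using init[of "insert j B"] init[of "insert i B"] ij less.prems by auto
  ultimately have "0 \<le> exp (c * t) * (\<mu> t (insert j B) - \<mu> t (insert i B))" by simp
  then show ?case by (simp add: zero_le_mult_iff)
qed

text \<open>For \<open>B = {}\<close> the first source is
  \<open>(\<rho> j 0 - \<rho> i 0) * \<mu> s {}\<close>, which is positive by
  \<open>empty_pos\<close>.\<close>

lemma singleton_less:
  assumes ij: "i \<in> V" "j \<in> V" and le: "\<And>k. \<rho> i k \<le> \<rho> j k" and less: "\<rho> i 0 < \<rho> j 0"
    and t: "0 < t"
  shows "\<mu> t {i} < \<mu> t {j}"
proof -
  have ne: "i \<noteq> j" using less by auto
  have B: "{} \<subseteq> V - {i, j}" by simp
  define c where "c = (\<Sum>l\<in>V - insert j {}. \<rho> l (Suc (card ({} :: 'v set))))"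
  have "(\<lambda>t. \<mu> t (insert j {}) - \<mu> t (insert i {})) 0 < exp (c * t) * (\<mu> t (insert j {}) - \<mu> t (insert i {}))"
  proof (rule exp_mult_strict_mono[OF exchange_equation[OF _ ij ne B] _ t])
    fix s :: real assume s: "0 < s"
    have "0 < (\<rho> j 0 - \<rho> i 0) * \<mu> s {}" using less empty_pos[of s] s by simp
    moreover have "0 \<le> (\<rho> j 1 - \<rho> i 1) * \<mu> s {i}"
      using le nonneg[of s "{i}"] ij s by simp
    ultimately show "0 < ((\<rho> j (card ({} :: 'v set)) - \<rho> i (card ({} :: 'v set))) * \<mu> s {}
     + (\<Sum>l\<in>{}. \<rho> l (card ({} :: 'v set)) * (\<mu> s (insert j ({} - {l})) - \<mu> s (insert i ({} - {l}))))
     + (\<rho> j (Suc (card ({} :: 'v set))) - \<rho> i (Suc (card ({} :: 'v set)))) * \<mu> s (insert i {}))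
    - (\<Sum>l\<in>V - insert j {}. \<rho> l (Suc (card ({} :: 'v set)))) * (\<mu> s (insert j {}) - \<mu> s (insert i {}))
    + c * (\<mu> s (insert j {}) - \<mu> s (insert i {}))"
      unfolding c_def by simp
  qed
  then have "0 < exp (c * t) * (\<mu> t {j} - \<mu> t {i})" using init[of "{i}"] init[of "{j}"] ij by simp
  then show ?thesis by (simp add: zero_less_mult_iff)
qed

lemma member_mass_mono:
  assumes ij: "i \<in> V" "j \<in> V" and le: "\<And>k. \<rho> i k \<le> \<rho> j k" and t: "0 \<le> t"
  shows "member_mass V (\<mu> t) k i \<le> member_mass V (\<mu> t) k j"
proof (cases "i = j")
  case False
  have "(\<Sum>B | B \<subseteq> V - {i, j} \<and> Suc (card B) = k. \<mu> t (insert i B))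
     \<le> (\<Sum>B | B \<subseteq> V - {i, j} \<and> Suc (card B) = k. \<mu> t (insert j B))"
    using exchange_le[OF ij False le _ t] by (intro sum_mono) auto
  then show ?thesis
    using member_mass_split[OF fin ij False, of "\<mu> t" k] member_mass_split[OF fin ij(2,1) False[symmetric], of "\<mu> t" k]
    by (simp add: insert_commute conj_commute)
qed simp

text \<open>The rates have to be ordered uniformly in \<open>k\<close>, because the mass at one
  level depends on the rates at the levels below.\<close>

lemma comonotone_member_mass:
  assumes "i \<in> V" "j \<in> V" "0 \<le> t"
    and "(\<forall>k. \<rho> i k \<le> \<rho> j k) \<or> (\<forall>k. \<rho> j k \<le> \<rho> i k)"
  shows "0 \<le> (\<rho> i k - \<rho> j k) * (member_mass V (\<mu> t) k i - member_mass V (\<mu> t) k j)"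
  using assms(4)
proof
  assume "\<forall>k. \<rho> i k \<le> \<rho> j k"
  then show ?thesis
    using member_mass_mono[of i j t k] assms by (intro mult_nonpos_nonpos) auto
next
  assume "\<forall>k. \<rho> j k \<le> \<rho> i k"
  then show ?thesis
    using member_mass_mono[of j i t k] assms by (intro mult_nonneg_nonneg) auto
qed

section \<open>Tail probabilities and their comparison\<close>

lemma tail_mass_0:
  assumes "0 \<le> t"
  shows "tail_mass V (\<mu> t) 0 = 1"
  using total[OF assms] by (simp add: tail_mass_def)

lemma tail_mass_Suc_init: "tail_mass V (\<mu> 0) (Suc k) = 0"
  unfolding tail_mass_def by (intro sum.neutral) (auto simp: init)

lemma tail_mass_has_derivative:
  assumes t: "0 \<le> t"
  shows "((\<lambda>t. tail_mass V (\<mu> t) (Suc k)) has_real_derivative outflow V \<rho> (\<mu> t) k) (at t within {0..})"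
proof -
  \<comment> \<open>One new adopter crosses the threshold \<open>Suc k\<close> only from size
    exactly \<open>k\<close>.\<close>
  have "(\<Sum>j\<in>V - A. \<rho> j (card A) * (of_bool (Suc k \<le> card (insert j A)) - of_bool (Suc k \<le> card A)))
    = of_bool (card A = k) * (\<Sum>j\<in>V - A. \<rho> j k)" if "A \<in> Pow V" for A
  proof -
    have "finite A" using that fin finite_subset by blast
    then have "\<rho> j (card A) * (of_bool (Suc k \<le> card (insert j A)) - of_bool (Suc k \<le> card A))
      = of_bool (card A = k) * \<rho> j k" if "j \<in> V - A" for j
      using that by auto
    then show ?thesis unfolding sum_distrib_left by (intro sum.cong) auto
  qed
  then have "(\<Sum>A\<in>Pow V. \<mu> t A * (\<Sum>j\<in>V - A. \<rho> j (card A) *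
      (of_bool (Suc k \<le> card (insert j A)) - of_bool (Suc k \<le> card A)))) = outflow V \<rho> (\<mu> t) k"
    unfolding outflow_def by (intro sum.cong) auto
  then show ?thesis
    using dynkin[OF t, of "\<lambda>A. of_bool (Suc k \<le> card A)"] unfolding tail_mass_def by simp
qed

lemma expected_card_less_homogeneous:
  assumes hom: "set_growth V (\<lambda>_. mean_rate V \<rho>) \<nu>" and t: "0 < t"
    and comparable: "\<And>i j. i \<in> V \<Longrightarrow> j \<in> V \<Longrightarrow> (\<forall>k. \<rho> i k \<le> \<rho> j k) \<or> (\<forall>k. \<rho> j k \<le> \<rho> i k)"
    and ab: "a \<in> V" "b \<in> V" "\<rho> a 0 < \<rho> b 0" "\<rho> a 1 < \<rho> b 1"
  shows "(\<Sum>A\<in>Pow V. \<mu> t A * real (card A)) < (\<Sum>A\<in>Pow V. \<nu> t A * real (card A))"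
proof -
  interpret hom: set_growth V "\<lambda>_. mean_rate V \<rho>" \<nu> by (rule hom)
  have "V \<noteq> {}" using ab by auto
  have "card {a, b} \<le> card V" using ab fin by (intro card_mono) auto
  then have N: "2 \<le> card V" using ab by (auto simp: card_insert_if split: if_splits)
  \<comment> \<open>The total adoption rate of the homogeneous network with \<open>k\<close>
    adopters.\<close>
  define \<beta> where "\<beta> k = (real (card V) - real k) * mean_rate V \<rho> k" for k
  define \<Delta> where "\<Delta> k s = tail_mass V (\<nu> s) k - tail_mass V (\<mu> s) k" for k s
  have deriv: "(\<Delta> (Suc k) has_real_derivative outflow V (\<lambda>_. mean_rate V \<rho>) (\<nu> s) k - outflow V \<rho> (\<mu> s) k)
      (at s within {0..})" if "0 \<le> s" for k s
    unfolding \<Delta>_def[abs_def]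
    by (intro DERIV_diff tail_mass_has_derivative hom.tail_mass_has_derivative that)
  have \<Delta>_0: "\<Delta> (Suc k) 0 = 0" for k
    unfolding \<Delta>_def by (simp add: tail_mass_Suc_init hom.tail_mass_Suc_init)
  \<comment> \<open>The level mass is a difference of consecutive tails, so adding
    \<open>\<beta> k * \<Delta> (Suc k) s\<close> leaves the previous tail gap plus the Chebyshev
    deficit of the heterogeneous network.\<close>
  have gap: "outflow V (\<lambda>_. mean_rate V \<rho>) (\<nu> s) k - outflow V \<rho> (\<mu> s) k + \<beta> k * \<Delta> (Suc k) s
    = \<beta> k * \<Delta> k s + (\<beta> k * level_mass V (\<mu> s) k - outflow V \<rho> (\<mu> s) k)" for k s
    unfolding \<Delta>_def tail_mass_Suc[of V _ k] outflow_const[OF fin] \<beta>_def by (simp add: algebra_simps)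
  have le: "0 \<le> \<beta> k * level_mass V (\<mu> s) k - outflow V \<rho> (\<mu> s) k" if "0 \<le> s" for k s
    using outflow_le[OF fin \<open>V \<noteq> {}\<close>, of \<rho> k "\<mu> s"] comonotone_member_mass[OF _ _ that comparable]
    unfolding \<beta>_def by auto
  \<comment> \<open>Level 1 is the first where strictness can arise: at level 0 only the empty set
    occurs, and both networks leave it at the same total rate.\<close>
  have less: "0 < \<beta> 1 * level_mass V (\<mu> s) 1 - outflow V \<rho> (\<mu> s) 1" if s: "0 < s" for s
  proof -
    have "\<And>k. \<rho> a k \<le> \<rho> b k" using comparable[OF ab(1,2)] ab(3) by (metis not_le)
    then have "\<mu> s {a} < \<mu> s {b}" using singleton_less[OF ab(1,2) _ ab(3) s] by blast
    then have "0 < (\<rho> a 1 - \<rho> b 1) * (member_mass V (\<mu> s) 1 a - member_mass V (\<mu> s) 1 b)"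
      using ab unfolding member_mass_singleton[OF fin ab(1)] member_mass_singleton[OF fin ab(2)]
      by (intro mult_neg_neg) auto
    then show ?thesis
      using outflow_less[OF fin \<open>V \<noteq> {}\<close> _ ab(1,2), of \<rho> 1 "\<mu> s"] comonotone_member_mass[OF _ _ _ comparable, of _ _ s 1] s
      unfolding \<beta>_def by auto
  qed
  \<comment> \<open>The factor \<open>card V - k\<close> forces the restriction to
    \<open>k \<le> card V\<close>, which the induction below inherits.\<close>
  have \<beta>_nonneg: "0 \<le> \<beta> k" if "k \<le> card V" for k
    unfolding \<beta>_def mean_rate_def using that rate_nonneg by (auto intro!: mult_nonneg_nonneg divide_nonneg_nonneg sum_nonneg)
  have \<Delta>_nonneg: "0 \<le> \<Delta> k s" if "k \<le> card V" "0 \<le> s" for k s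
    using that
  proof (induction k arbitrary: s)
    case 0
    then show ?case by (simp add: \<Delta>_def tail_mass_0 hom.tail_mass_0)
  next
    case (Suc k)
    have "\<Delta> (Suc k) 0 \<le> exp (\<beta> k * s) * \<Delta> (Suc k) s"
    proof (rule exp_mult_mono[OF deriv _ Suc.prems(2)])
      fix u :: real assume u: "0 \<le> u"
      show "0 \<le> outflow V (\<lambda>_. mean_rate V \<rho>) (\<nu> u) k - outflow V \<rho> (\<mu> u) k + \<beta> k * \<Delta> (Suc k) u"
        unfolding gap using Suc.IH[of u] Suc.prems u le[OF u, of k] \<beta>_nonneg[of k] by simp
    qed
    then show ?case unfolding \<Delta>_0 by (simp add: zero_le_mult_iff)
  qed
  have "\<Delta> (Suc 1) 0 < exp (\<beta> 1 * t) * \<Delta> (Suc 1) t"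
  proof (rule exp_mult_strict_mono[OF deriv _ t])
    fix u :: real assume u: "0 < u"
    have "0 \<le> \<beta> 1 * \<Delta> 1 u" using \<beta>_nonneg[of 1] \<Delta>_nonneg[of 1 u] N u by simp
    then show "0 < outflow V (\<lambda>_. mean_rate V \<rho>) (\<nu> u) 1 - outflow V \<rho> (\<mu> u) 1 + \<beta> 1 * \<Delta> (Suc 1) u"
      unfolding gap using less[OF u] by linarith
  qed
  then have "0 < \<Delta> (Suc 1) t" unfolding \<Delta>_0 by (simp add: zero_less_mult_iff)
  then have "tail_mass V (\<mu> t) 2 < tail_mass V (\<nu> t) 2"
    unfolding \<Delta>_def by (simp add: numeral_2_eq_2)
  moreover have "tail_mass V (\<mu> t) k \<le> tail_mass V (\<nu> t) k" if "k \<le> card V" for k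
    using \<Delta>_nonneg[OF that, of t] t unfolding \<Delta>_def by simp
  \<comment> \<open>\<open>N\<close> places the strict index 2 within the range of
    summation.\<close>
  ultimately have "(\<Sum>k=1..card V. tail_mass V (\<mu> t) k) < (\<Sum>k=1..card V. tail_mass V (\<nu> t) k)"
    using N by (intro sum_strict_mono_ex1) auto
  then show ?thesis unfolding sum_card_eq_sum_tail_mass[OF fin] .
qed

end

section \<open>Reduction of the two Bass processes to growing adopter sets\<close>

theorem theorem5:
  fixes M :: nat
    and p q :: "nat \<Rightarrow> real"
    and \<Omega>het :: "'a measure" and Xhet :: "real \<Rightarrow> 'a \<Rightarrow> nat \<Rightarrow> nat"
    and \<Omega>hom :: "'b measure" and Xhom :: "real \<Rightarrow> 'b \<Rightarrow> nat \<Rightarrow> nat"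
    and t :: real
  assumes "2 \<le> M"
    and "0 \<le> p 1" and "mono_on {1..M} p" and "\<exists>i\<in>{1..M}. \<exists>j\<in>{1..M}. p i \<noteq> p j"
    and "0 < q 1" and "mono_on {1..M} q" and "\<exists>i\<in>{1..M}. \<exists>j\<in>{1..M}. q i \<noteq> q j"
    and "bass_process \<Omega>het M p (\<lambda>i j. q j / (real M - 1)) Xhet"
    and "bass_process \<Omega>hom M (\<lambda>j. (\<Sum>i=1..M. p i) / real M)
           (\<lambda>i j. ((\<Sum>k=1..M. q k) / real M) / (real M - 1)) Xhom"
    and "0 < t"
  shows "expected_adopter_fraction \<Omega>het M Xhet t < expected_adopter_fraction \<Omega>hom M Xhom t"
proof -
  let ?V = "{1..M}"
  have pq_mono: "p i \<le> p j" "q i \<le> q j" if "i \<in> ?V" "j \<in> ?V" "i \<le> j" for i j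
    using that assms(3,6) by (auto simp: monotone_on_def)
  have p: "0 \<le> p j" and q: "0 \<le> q j" if "j \<in> ?V" for j
    using pq_mono[of 1 j] that assms(1,2,5) by auto
  have M: "0 < real M - 1" using assms(1) by simp
  have q': "0 \<le> q j / (real M - 1)" if "j \<in> ?V" for j
    using q[OF that] M by simp
  have p_mean: "0 \<le> (\<Sum>i=1..M. p i) / real M"
    using p by (intro divide_nonneg_nonneg sum_nonneg) auto
  have q_mean: "0 \<le> (\<Sum>k=1..M. q k) / real M / (real M - 1)"
    using q M by (intro divide_nonneg_nonneg sum_nonneg) auto
  define \<rho> where "\<rho> = (\<lambda>j k. p j + q j / (real M - 1) * real k)"
  obtain \<mu> where \<mu>: "set_growth ?V \<rho> \<mu>"
    and fhet: "\<forall>t\<ge>0. expected_adopter_fraction \<Omega>het M Xhet t = 1 / real M * (\<Sum>A\<in>Pow ?V. \<mu> t A * real (card A))"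
    using bass_process_set_growth[OF assms(8) p q'] unfolding \<rho>_def by blast
  obtain \<nu> where \<nu>: "set_growth ?V (\<lambda>j k. (\<Sum>i=1..M. p i) / real M + (\<Sum>k=1..M. q k) / real M / (real M - 1) * real k) \<nu>"
    and fhom: "\<forall>t\<ge>0. expected_adopter_fraction \<Omega>hom M Xhom t = 1 / real M * (\<Sum>A\<in>Pow ?V. \<nu> t A * real (card A))"
    using bass_process_set_growth[OF assms(9) p_mean q_mean] by blast
  \<comment> \<open>The rates are affine in \<open>k\<close>, so averaging them averages the
    coefficients and yields exactly the rate of the homogeneous network.\<close>
  have "mean_rate ?V \<rho> = (\<lambda>k. (\<Sum>i=1..M. p i) / real M + (\<Sum>k=1..M. q k) / real M / (real M - 1) * real k)"
    unfolding mean_rate_def \<rho>_def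
    by (rule ext) (simp add: sum.distrib add_divide_distrib mult.commute flip: sum_distrib_left sum_distrib_right sum_divide_distrib)
  then have \<nu>': "set_growth ?V (\<lambda>_. mean_rate ?V \<rho>) \<nu>"
    using \<nu> by (simp only:)
  have \<rho>_mono: "\<rho> i k \<le> \<rho> j k" if "i \<in> ?V" "j \<in> ?V" "i \<le> j" for i j k
    unfolding \<rho>_def using pq_mono[OF that] M by (intro add_mono mult_right_mono divide_right_mono) auto
  obtain i j where "i \<in> ?V" "j \<in> ?V" "p i \<noteq> p j" using assms(4) by blast
  then obtain a b where ab: "a \<in> ?V" "b \<in> ?V" "a \<le> b" "p a \<noteq> p b"
    by (metis nat_le_linear)
  then have pab: "p a < p b" using pq_mono(1)[of a b] by simp
  interpret set_growth ?V \<rho> \<mu> by (rule \<mu>)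
  have "(\<Sum>A\<in>Pow ?V. \<mu> t A * real (card A)) < (\<Sum>A\<in>Pow ?V. \<nu> t A * real (card A))"
  proof (rule expected_card_less_homogeneous[OF \<nu>' assms(10) _ ab(1,2)])
    show "(\<forall>k. \<rho> i k \<le> \<rho> j k) \<or> (\<forall>k. \<rho> j k \<le> \<rho> i k)" if "i \<in> ?V" "j \<in> ?V" for i j
      using \<rho>_mono that by (metis nat_le_linear)
    show "\<rho> a 0 < \<rho> b 0" using pab by (simp add: \<rho>_def)
    \<comment> \<open>The strict gap comes from \<open>p\<close>; the \<open>q\<close> part is
      ordered the same way and preserves it.\<close>
    show "\<rho> a 1 < \<rho> b 1"
      using pab divide_right_mono[OF pq_mono(2)[OF ab(1-3)], of "real M - 1"] M by (simp add: \<rho>_def)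
  qed
  then show ?thesis
    using fhet fhom assms(1,10) by (simp add: divide_strict_right_mono)
qed

end
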